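(* Let $r\in\mathbb{N}$ and let $f\colon\mathbb{N}\to\mathbb{C}$ be an $r$-even function. i) Uniformly for $x$ and $r$ (with $x\ge 1$ real and an absolute implied constant), $$\sum_{n\le x}\frac{\widehat{f}(n)}{n}=f(r)(\log x+C)-(f*\Lambda)(r)+O\left(x^{-1}V_f(x)\right),\qquad V_f(x)=\sum_{d\mid r}d\,|f'(r/d)|,$$ where $C$ is Euler's constant. ii) If $f(r)=0$, then $$\sum_{n=1}^{\infty}\frac{\widehat{f}(n)}{n}=-(f*\Lambda)(r).$$
   Context: $\mathbb{N}=\{1,2,\ldots\}$. A function $f\colon\mathbb{N}\to\mathbb{C}$ is $r$-even if $f(\gcd(n,r))=f(n)$ for all $n\in\mathbb{N}$ (in particular it is $r$-periodic). Its discrete Fourier transform is $\widehat{f}(n)=\sum_{k=1}^{r}f(k)\exp(-2\pi i kn/r)$, $n\in\mathbb{N}$. The Dirichlet convolution is $(f*g)(n)=\sum_{d\mid n}f(d)g(n/d)$; $f'=\mu*f$ with $\mu$ the Möbius function; $\Lambda$ is the von Mangoldt function. (The quantity $V_f(x)$ does not actually depend on $x$.) The infinite series in ii) is understood as the limit of its partial sums. *)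

theory Defs
  imports
    "HOL-Analysis.Analysis"
    "HOL-Computational_Algebra.Squarefree"
    "HOL-Number_Theory.Prime_Powers"
begin

text \<open>
  Functions on the positive integers are represented by functions on \<^typ>\<open>nat\<close>;
  in the definitions below their value at \<open>0\<close> is irrelevant as long as all
  arguments and the modulus \<open>r\<close> are positive.
\<close>

definition r_even :: "nat \<Rightarrow> (nat \<Rightarrow> complex) \<Rightarrow> bool" where
  "r_even r f \<longleftrightarrow> (\<forall>n\<ge>1. f (gcd n r) = f n)"

definition dft :: "nat \<Rightarrow> (nat \<Rightarrow> complex) \<Rightarrow> nat \<Rightarrow> complex" where
  "dft r f n =
     (\<Sum>k=1..r. f k * exp (- (2 * of_real pi * \<i> * of_nat k * of_nat n / of_nat r)))"

definition dirichlet_conv ::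
    "(nat \<Rightarrow> complex) \<Rightarrow> (nat \<Rightarrow> complex) \<Rightarrow> nat \<Rightarrow> complex" where
  "dirichlet_conv f g n = (\<Sum>d | d dvd n. f d * g (n div d))"

definition moebius :: "nat \<Rightarrow> complex" where
  "moebius n = (if squarefree n then (-1) ^ card (prime_factors n) else 0)"

text \<open>The function \<open>f' = \<mu> * f\<close>.\<close>

definition moebius_transform :: "(nat \<Rightarrow> complex) \<Rightarrow> nat \<Rightarrow> complex" where
  "moebius_transform f = dirichlet_conv moebius f"

text \<open>The quantity \<open>V\<^sub>f(x)\<close>, which depends on \<open>r\<close> but not on \<open>x\<close>.\<close>

definition V :: "nat \<Rightarrow> (nat \<Rightarrow> complex) \<Rightarrow> real" where
  "V r f = (\<Sum>d | d dvd r. real d * norm (moebius_transform f (r div d)))"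

end

theory Submission
  imports Defs
begin

text \<open>
  Write \<open>g = \<mu> * f\<close>, so that \<open>f k = (\<Sum>d | d dvd gcd k r. g d)\<close> for an \<open>r\<close>-even \<open>f\<close>. Transforming
  this expansion termwise, the multiples \<open>k\<close> of \<open>d\<close> contribute a full sum of \<open>r/d\<close>-th roots of
  unity, which detects divisibility of \<open>n\<close> by \<open>e = r/d\<close>. Hence the transform of \<open>f\<close> is the sum of
  \<open>e * g (r/e)\<close> over the common divisors \<open>e\<close> of \<open>r\<close> and \<open>n\<close> (\<open>dft_r_even\<close>). Dividing by \<open>n\<close> and
  summing over the multiples \<open>n = e * m\<close> of \<open>e\<close> up to \<open>x\<close> turns the sum in question into a
  combination of harmonic numbers,
  \[ \sum_{e \mid r} g(r/e) \, H(\lfloor x/e \rfloor), \]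
  without any error (\<open>sum_dft_over_n\<close>).

  Now \<open>H(\<lfloor>y\<rfloor>) = ln y + C + O(1/y)\<close> holds for all \<open>y > 0\<close>, not only for \<open>y \<ge> 1\<close>
  (\<open>harm_floor_bound\<close>), so divisors \<open>e > x\<close> need no separate treatment and the total error is
  at most a constant times \<open>(\<Sum>e | e dvd r. e * |g (r/e)|) / x = V r f / x\<close>. In the main
  term the coefficients \<open>g (r/e)\<close> add up to \<open>f r\<close>, and the contribution of \<open>ln e\<close> is
  \<open>(g * ln) r = (g * 1 * \<Lambda>) r = (f * \<Lambda>) r\<close> because \<open>ln = 1 * \<Lambda>\<close>. When \<open>f r = 0\<close>, the term
  growing with \<open>x\<close> disappears and letting \<open>x\<close> run through the integers gives the series.
\<close>

section \<open>Dirichlet convolution and Moebius inversion\<close>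

lemma dirichlet_conv_cong:
  assumes "n > 0" "\<And>d. d > 0 \<Longrightarrow> f d = f' d" "\<And>d. d > 0 \<Longrightarrow> g d = g' d"
  shows "dirichlet_conv f g n = dirichlet_conv f' g' n"
  unfolding dirichlet_conv_def
proof (rule sum.cong[OF refl])
  fix d assume "d \<in> {d. d dvd n}"
  then have "d > 0" "n div d > 0"
    using assms(1) by (auto intro!: Nat.gr0I simp: div_eq_0_iff dvd_imp_le dest: dvd_imp_le)
  then show "f d * g (n div d) = f' d * g' (n div d)"
    using assms by simp
qed

lemma dirichlet_conv_commute:
  assumes "n > 0"
  shows "dirichlet_conv f g n = dirichlet_conv g f n"
  unfolding dirichlet_conv_def
  by (rule sum.reindex_bij_witness[where i = "\<lambda>d. n div d" and j = "\<lambda>d. n div d"])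
     (use assms in \<open>auto simp: mult.commute\<close>)

text \<open>Both sides are the sum over all factorisations of \<open>n\<close> into three ordered factors.\<close>

lemma dirichlet_conv_assoc:
  assumes "n > 0"
  shows "dirichlet_conv (dirichlet_conv f g) h n = dirichlet_conv f (dirichlet_conv g h) n"
proof -
  have fin: "finite {d. d dvd m}" if "m dvd n" for m
    using that assms by (intro finite_divisors_nat) (auto intro!: Nat.gr0I)
  have "dirichlet_conv (dirichlet_conv f g) h n =
          (\<Sum>(d, e)\<in>(SIGMA d:{d. d dvd n}. {e. e dvd d}). f e * g (d div e) * h (n div d))"
    unfolding dirichlet_conv_def sum_distrib_right
    by (rule sum.Sigma) (use fin in auto)
  also have "\<dots> = (\<Sum>(e, m)\<in>(SIGMA e:{e. e dvd n}. {m. m dvd n div e}).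
                    f e * (g m * h (n div e div m)))"
    by (rule sum.reindex_bij_witness[where
          i = "\<lambda>(e, m). (e * m, e)" and j = "\<lambda>(d, e). (e, d div e)"])
       (use assms in \<open>auto simp: mult_ac div_mult2_eq elim!: dvdE\<close>)
  also have "\<dots> = dirichlet_conv f (dirichlet_conv g h) n"
    unfolding dirichlet_conv_def sum_distrib_left
    by (rule sum.Sigma[symmetric]) (use assms fin in \<open>auto intro: div_dvd_iff_mult\<close>)
  finally show ?thesis .
qed

text \<open>
  A squarefree divisor of \<open>n\<close> is the product of a unique set of prime factors of \<open>n\<close>, so the sum
  is the expansion of the product of \<open>1 - 1\<close> over the primes dividing \<open>n\<close>, which is empty only for \<open>n = 1\<close>.
\<close>

lemma sum_moebius_divisors:
  assumes "n > 0"
  shows "(\<Sum>d | d dvd n. moebius d) = (if n = 1 then 1 else 0)"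
proof -
  let ?P = "prime_factors n"
  have primes: "prime p" if "A \<subseteq> ?P" "p \<in> A" for A p
    using that by auto
  have factors: "prime_factors (\<Prod>A) = A" if "A \<subseteq> ?P" for A
  proof -
    have "finite A" using that finite_subset by blast
    moreover have "0 \<notin> A" using primes[OF that, of 0] by auto
    ultimately have "prime_factors (\<Prod>A) = (\<Union>p\<in>A. prime_factors p)"
      using prime_factors_prod[of A "\<lambda>p. p"] by simp
    also have "\<dots> = (\<Union>p\<in>A. {p})"
      using primes[OF that] by (intro SUP_cong refl) (simp add: prime_factorization_prime)
    finally show ?thesis by simp
  qed
  have squarefree: "squarefree (\<Prod>A)" if "A \<subseteq> ?P" for A
    by (rule squarefree_prod_coprime)
       (use primes[OF that] in \<open>auto intro: primes_coprime squarefree_prime\<close>)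
  have dvd: "\<Prod>A dvd n" if "A \<subseteq> ?P" for A
  proof -
    have "\<Prod>A dvd \<Prod>?P" using that by (intro prod_dvd_prod_subset) auto
    also have "\<dots> dvd (\<Prod>p\<in>?P. p ^ multiplicity p n)"
      by (intro prod_dvd_prod dvd_power) (auto simp: prime_factors_multiplicity)
    also have "\<dots> = n"
      using prime_factorization_nat[OF assms] by simp
    finally show ?thesis .
  qed
  have prod_factors: "\<Prod>(prime_factors d) = d" if "squarefree d" for d :: nat
  proof -
    have "d > 0" using that by (auto intro!: Nat.gr0I)
    have "(\<Prod>p\<in>prime_factors d. p ^ multiplicity p d) = d"
      using \<open>d > 0\<close> prime_factorization_nat[of d] by simp
    then show ?thesis
      using that \<open>d > 0\<close> by (simp add: squarefree_factorial_semiring')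
  qed
  have "(\<Sum>d | d dvd n. moebius d) = (\<Sum>d | d dvd n \<and> squarefree d. moebius d)"
    using assms by (intro sum.mono_neutral_right) (auto simp: moebius_def)
  also have "\<dots> = (\<Sum>A\<in>Pow ?P. (-1) ^ card A)"
    by (rule sum.reindex_bij_witness[where i = "\<lambda>A. \<Prod>A" and j = prime_factors])
       (use assms in \<open>auto simp: prod_factors factors squarefree dvd moebius_def
          dest: dvd_prime_factors[rotated]\<close>)
  also have "\<dots> = (\<Prod>p\<in>?P. 1 - 1)"
    by (subst prod_diff_conv_sum) auto
  also have "\<dots> = (if n = 1 then 1 else 0)"
    using assms by (auto simp: card_gt_0_iff prime_factorization_empty_iff)
  finally show ?thesis .
qed

lemma sum_moebius_transform:
  assumes "n > 0"
  shows "(\<Sum>d | d dvd n. moebius_transform f d) = f n"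
proof -
  let ?one = "\<lambda>_::nat. 1 :: complex"
  have "(\<Sum>d | d dvd n. moebius_transform f d) = dirichlet_conv (dirichlet_conv moebius f) ?one n"
    by (simp add: moebius_transform_def dirichlet_conv_def)
  also have "\<dots> = dirichlet_conv ?one (dirichlet_conv moebius f) n"
    by (rule dirichlet_conv_commute[OF assms])
  also have "\<dots> = dirichlet_conv (dirichlet_conv ?one moebius) f n"
    by (rule dirichlet_conv_assoc[OF assms, symmetric])
  also have "\<dots> = dirichlet_conv (\<lambda>d. if d = 1 then 1 else 0) f n"
    by (rule dirichlet_conv_cong[OF assms])
       (simp_all add: dirichlet_conv_commute[of _ ?one] sum_moebius_divisors
          dirichlet_conv_def[of moebius ?one])
  also have "\<dots> = (\<Sum>d\<in>{1::nat}. f n)"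
    unfolding dirichlet_conv_def
    by (rule sum.mono_neutral_cong_right) (use assms in auto)
  finally show ?thesis by simp
qed

text \<open>Since \<open>ln = 1 * \<Lambda>\<close>, this is \<open>(\<mu> * f) * (1 * \<Lambda>) = f * \<Lambda>\<close>.\<close>

lemma sum_moebius_transform_ln:
  assumes "r > 0"
  shows "(\<Sum>e | e dvd r. moebius_transform f (r div e) * of_real (ln (real e))) =
           dirichlet_conv f mangoldt r"
proof -
  let ?one = "\<lambda>_::nat. 1 :: complex" and ?g = "moebius_transform f"
  let ?ln = "\<lambda>n::nat. of_real (ln (real n)) :: complex"
  have "(\<Sum>e | e dvd r. ?g (r div e) * ?ln e) = dirichlet_conv ?ln ?g r"
    by (simp add: dirichlet_conv_def mult.commute)
  also have "\<dots> = dirichlet_conv ?g ?ln r"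
    by (rule dirichlet_conv_commute[OF assms])
  also have "\<dots> = dirichlet_conv ?g (dirichlet_conv ?one mangoldt) r"
    by (rule dirichlet_conv_cong[OF assms])
       (simp_all add: dirichlet_conv_commute[of _ ?one] dirichlet_conv_def[of mangoldt ?one]
          mangoldt_sum)
  also have "\<dots> = dirichlet_conv (dirichlet_conv ?g ?one) mangoldt r"
    by (rule dirichlet_conv_assoc[OF assms, symmetric])
  also have "\<dots> = dirichlet_conv f mangoldt r"
    by (rule dirichlet_conv_cong[OF assms])
       (simp_all add: dirichlet_conv_def[of ?g ?one] sum_moebius_transform)
  finally show ?thesis .
qed

section \<open>The discrete Fourier transform of an even function\<close>

lemma sum_exp_roots_of_unity:
  fixes q n :: nat
  assumes "q > 0"
  shows "(\<Sum>j=1..q. exp (- (2 * of_real pi * \<i> * of_nat j * of_nat n / of_nat q))) =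
           (if q dvd n then of_nat q else (0 :: complex))"
proof -
  define w :: complex where "w = exp (- (2 * of_real pi * \<i> * of_nat n / of_nat q))"
  have power: "exp (- (2 * of_real pi * \<i> * of_nat j * of_nat n / of_nat q)) = w ^ j" for j
    unfolding w_def exp_of_nat_mult[symmetric] by (simp add: field_simps)
  have w_eq_1: "w = 1 \<longleftrightarrow> q dvd n"
    using complex_root_unity_eq_1[of q n] assms
    by (simp add: w_def exp_minus)
  have "w ^ q = 1"
    using complex_root_unity_eq_1[of q "q * n"] assms
    by (simp add: power[symmetric] exp_minus mult_ac)
  then have "(\<Sum>j=1..q. w ^ j) = (if w = 1 then of_nat q else 0)"
    using assms by (auto simp: sum_gp)
  then show ?thesis
    by (simp add: power w_eq_1)
qed

text \<open>
  In the expansion of \<open>f\<close> into indicator functions of the multiples of \<open>d\<close>, with \<open>d\<close> dividing \<open>r\<close>,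
  each indicator transforms into \<open>r/d\<close> times the indicator of the multiples of \<open>r/d\<close>. For
  \<open>f = (\<lambda>k. if gcd k r = 1 then 1 else 0)\<close> the identity is the classical evaluation of
  Ramanujan's sum.
\<close>

lemma dft_r_even:
  assumes "r > 0" "r_even r f"
  shows "dft r f n =
           (\<Sum>e | e dvd r. if e dvd n then of_nat e * moebius_transform f (r div e) else 0)"
proof -
  let ?g = "moebius_transform f"
  let ?E = "\<lambda>k. exp (- (2 * of_real pi * \<i> * of_nat k * of_nat n / of_nat r)) :: complex"
  have f_expand: "f k = (\<Sum>d | d dvd r. if d dvd k then ?g d else 0)" if "k \<ge> 1" for k
  proof -
    have "f k = f (gcd k r)"
      using assms(2) that by (simp add: r_even_def)
    also have "\<dots> = (\<Sum>d | d dvd gcd k r. ?g d)"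
      using assms(1) by (intro sum_moebius_transform[symmetric]) simp
    also have "\<dots> = (\<Sum>d | d dvd r. if d dvd k then ?g d else 0)"
      by (rule sum.mono_neutral_cong_left) (use assms(1) in auto)
    finally show ?thesis .
  qed
  have multiples: "(\<Sum>k=1..r. if d dvd k then ?E k else 0) =
                     (if r div d dvd n then of_nat (r div d) else 0)" if "d dvd r" for d
  proof -
    obtain q where q: "r = d * q" using \<open>d dvd r\<close> by (elim dvdE)
    then have pos: "d > 0" "q > 0" using assms(1) by auto
    have "(\<Sum>k=1..r. if d dvd k then ?E k else 0) = (\<Sum>k | k \<in> {1..r} \<and> d dvd k. ?E k)"
      by (rule sum.mono_neutral_cong_right) auto
    also have "\<dots> = (\<Sum>j=1..q. ?E (d * j))"
      by (rule sum.reindex_bij_witness[where i = "\<lambda>j. d * j" and j = "\<lambda>k. k div d"])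
         (use pos q in \<open>auto elim!: dvdE\<close>)
    also have "\<dots> = (\<Sum>j=1..q. exp (- (2 * of_real pi * \<i> * of_nat j * of_nat n / of_nat q)))"
      using pos by (simp add: q field_simps)
    also have "\<dots> = (if q dvd n then of_nat q else 0)"
      by (rule sum_exp_roots_of_unity[OF pos(2)])
    finally show ?thesis using q pos by simp
  qed
  have "dft r f n = (\<Sum>k=1..r. \<Sum>d | d dvd r. ?g d * (if d dvd k then ?E k else 0))"
    unfolding dft_def
    by (intro sum.cong refl) (auto simp: f_expand sum_distrib_right intro!: sum.cong)
  also have "\<dots> = (\<Sum>d | d dvd r. ?g d * (\<Sum>k=1..r. if d dvd k then ?E k else 0))"
    by (subst sum.swap) (simp add: sum_distrib_left)
  also have "\<dots> = (\<Sum>d | d dvd r. ?g d * (if r div d dvd n then of_nat (r div d) else 0))"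
    by (intro sum.cong refl arg_cong2[where f = "(*)"] multiples) simp
  also have "\<dots> = (\<Sum>e | e dvd r. if e dvd n then of_nat e * ?g (r div e) else 0)"
    by (rule sum.reindex_bij_witness[where i = "\<lambda>d. r div d" and j = "\<lambda>d. r div d"])
       (use assms(1) in auto)
  finally show ?thesis .
qed

section \<open>Reduction to harmonic numbers\<close>

lemma sum_dft_over_n:
  assumes "r > 0" "r_even r f"
  shows "(\<Sum>n=1..N. dft r f n / of_nat n) =
           (\<Sum>e | e dvd r. moebius_transform f (r div e) * of_real (harm (N div e)))"
proof -
  let ?g = "moebius_transform f"
  have multiples: "(\<Sum>n=1..N. if e dvd n then of_nat e * ?g (r div e) / of_nat n else 0) =
                     ?g (r div e) * of_real (harm (N div e))" if "e dvd r" for e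
  proof -
    have "e > 0" using that assms(1) by (auto intro!: Nat.gr0I)
    have "(\<Sum>n=1..N. if e dvd n then of_nat e * ?g (r div e) / of_nat n else 0) =
            (\<Sum>n | n \<in> {1..N} \<and> e dvd n. of_nat e * ?g (r div e) / of_nat n)"
      by (rule sum.mono_neutral_cong_right) auto
    also have "\<dots> = (\<Sum>m=1..N div e. of_nat e * ?g (r div e) / of_nat (e * m))"
      by (rule sum.reindex_bij_witness[where i = "\<lambda>m. e * m" and j = "\<lambda>n. n div e"])
         (use \<open>e > 0\<close> in \<open>auto elim!: dvdE simp: less_eq_div_iff_mult_less_eq mult.commute
            Suc_le_eq\<close>)
    also have "\<dots> = ?g (r div e) * of_real (harm (N div e))"
      using \<open>e > 0\<close> by (simp add: harm_def sum_distrib_left field_simps)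
    finally show ?thesis .
  qed
  have "(\<Sum>n=1..N. dft r f n / of_nat n) =
          (\<Sum>n=1..N. \<Sum>e | e dvd r. if e dvd n then of_nat e * ?g (r div e) / of_nat n else 0)"
    by (auto simp: dft_r_even[OF assms] sum_divide_distrib intro!: sum.cong)
  also have "\<dots> = (\<Sum>e | e dvd r. ?g (r div e) * of_real (harm (N div e)))"
    by (subst sum.swap) (intro sum.cong refl multiples, simp)
  finally show ?thesis .
qed

text \<open>
  For \<open>y \<ge> 1\<close> and \<open>N = \<lfloor>y\<rfloor>\<close>, both \<open>harm N - C\<close> and \<open>ln y\<close> lie between \<open>ln (N + 1) - 1 / N\<close>
  and \<open>ln (N + 1)\<close>, and \<open>1 / N \<le> 2 / y\<close>. For \<open>y < 1\<close> the harmonic number vanishes, and the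
  bound holds because \<open>- ln y\<close> is smaller than \<open>1 / y\<close>.
\<close>

lemma harm_floor_bound:
  fixes y :: real
  assumes "y > 0"
  shows "\<bar>harm (nat \<lfloor>y\<rfloor>) - (ln y + euler_mascheroni)\<bar> \<le> 2 / y"
proof (cases "y < 1")
  case True
  then have "nat \<lfloor>y\<rfloor> = 0" using assms by simp
  moreover have "ln y \<le> 0" using True assms by simp
  moreover have "- ln y \<le> 1 / y - 1"
    using ln_le_minus_one[of "1 / y"] assms by (simp add: ln_div)
  moreover have "1 / y \<ge> 1" using True assms by simp
  moreover have "(euler_mascheroni :: real) < 1"
    using euler_mascheroni_less_13_over_22 by simp
  moreover have "2 / y = 1 / y + 1 / y" by simp
  ultimately show ?thesis
    using euler_mascheroni_pos by (simp add: harm_def)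
next
  case False
  define N where "N = nat \<lfloor>y\<rfloor>"
  have N: "N \<ge> 1" "real N \<le> y" "y < real N + 1"
    using False by (auto simp: N_def le_nat_iff)
  let ?C = "euler_mascheroni :: real"
  have C: "?C \<ge> harm N - ln (real N + 1)" "?C \<le> harm N - ln (real N + 1) + 1 / real N"
  proof -
    let ?t = "harm N - ln (real (Suc N))"
    have "?t + inverse (real (2 * (N + 1))) \<le> ?C" "?C \<le> ?t + inverse (real (2 * N))"
      using euler_mascheroni_bounds[OF N(1)] by auto
    moreover have "0 \<le> inverse (real (2 * (N + 1)))" "inverse (real (2 * N)) \<le> 1 / real N"
      using N(1) by (auto simp: field_simps)
    moreover have "real (Suc N) = real N + 1" by simp
    ultimately show "?C \<ge> harm N - ln (real N + 1)"
        "?C \<le> harm N - ln (real N + 1) + 1 / real N"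
      by (smt (verit))+
  qed
  have "ln (real N + 1) - ln y \<le> ln (real N + 1) - ln (real N)"
    using N by simp
  also have "\<dots> \<le> 1 / real N"
    using N(1) ln_le_minus_one[of "(real N + 1) / real N"] by (simp add: ln_div field_simps)
  finally have "ln (real N + 1) - ln y \<le> 1 / real N" .
  moreover have "ln y \<le> ln (real N + 1)"
    using N assms by simp
  moreover have "1 / real N \<le> 2 / y"
    using N assms by (simp add: field_simps)
  ultimately show ?thesis
    using C unfolding N_def[symmetric] by linarith
qed

lemma sum_dft_asymptotics:
  assumes "r > 0" "r_even r f" "x > 0"
  shows "norm ((\<Sum>n=1..nat \<lfloor>x\<rfloor>. dft r f n / of_nat n)
               - (f r * of_real (ln x + euler_mascheroni) - dirichlet_conv f mangoldt r))
           \<le> 2 * (V r f / x)"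
proof -
  let ?g = "moebius_transform f" and ?C = "euler_mascheroni :: real"
  let ?err = "\<lambda>e. harm (nat \<lfloor>x / real e\<rfloor>) - (ln (x / real e) + ?C)"
  have pos: "e > 0" if "e dvd r" for e
    using that assms(1) by (auto intro!: Nat.gr0I)
  have f_r: "f r = (\<Sum>e | e dvd r. ?g (r div e))"
  proof -
    have "f r = (\<Sum>d | d dvd r. ?g d)"
      by (rule sum_moebius_transform[OF assms(1), symmetric])
    also have "\<dots> = (\<Sum>e | e dvd r. ?g (r div e))"
      by (rule sum.reindex_bij_witness[where i = "\<lambda>d. r div d" and j = "\<lambda>d. r div d"])
         (use assms(1) in auto)
    finally show ?thesis .
  qed
  have floor_div: "nat \<lfloor>x\<rfloor> div e = nat \<lfloor>x / real e\<rfloor>" for e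
    using assms(3) floor_divide_real_eq_div[of "int e" x] by (simp add: nat_div_distrib)
  have main: "f r * of_real (ln x + ?C) - dirichlet_conv f mangoldt r =
          (\<Sum>e | e dvd r. ?g (r div e) * of_real (ln (x / real e) + ?C))"
    unfolding f_r sum_moebius_transform_ln[OF assms(1), symmetric] sum_distrib_right
      sum_subtractf[symmetric]
    by (intro sum.cong refl) (use pos assms(3) in \<open>auto simp: ln_div algebra_simps\<close>)
  have "(\<Sum>n=1..nat \<lfloor>x\<rfloor>. dft r f n / of_nat n)
          - (f r * of_real (ln x + ?C) - dirichlet_conv f mangoldt r) =
        (\<Sum>e | e dvd r. ?g (r div e) * of_real (?err e))"
    unfolding main sum_dft_over_n[OF assms(1,2)] floor_div
    by (simp add: sum_subtractf[symmetric] algebra_simps)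
  also have "norm \<dots> \<le> (\<Sum>e | e dvd r. norm (?g (r div e)) * (2 * real e / x))"
  proof (rule sum_norm_le)
    fix e assume "e \<in> {e. e dvd r}"
    then have "\<bar>?err e\<bar> \<le> 2 * real e / x"
      using harm_floor_bound[of "x / real e"] pos[of e] assms(3) by simp
    then show "norm (?g (r div e) * of_real (?err e)) \<le> norm (?g (r div e)) * (2 * real e / x)"
      unfolding norm_mult norm_of_real by (intro mult_left_mono) auto
  qed
  also have "\<dots> = 2 * (V r f / x)"
    by (simp add: V_def sum_distrib_left sum_divide_distrib mult_ac)
  finally show ?thesis .
qed

lemma dft_series_sums:
  assumes "r > 0" "r_even r f" "f r = 0"
  shows "(\<lambda>n. dft r f (Suc n) / of_nat (Suc n)) sums (- dirichlet_conv f mangoldt r)"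
proof -
  let ?S = "\<lambda>N. \<Sum>n<N. dft r f (Suc n) / of_nat (Suc n)"
  have "norm (?S N - (- dirichlet_conv f mangoldt r)) \<le> 2 * V r f * inverse (real N)"
    if "N > 0" for N
    using sum_dft_asymptotics[OF assms(1,2), of "real N"] that assms(3)
    by (simp add: sum.atLeast1_atMost_eq divide_inverse)
  then have "eventually (\<lambda>N. norm (?S N - (- dirichlet_conv f mangoldt r))
                               \<le> 2 * V r f * inverse (real N)) sequentially"
    using eventually_gt_at_top[of 0] by (rule eventually_mono[rotated])
  moreover have "(\<lambda>N. 2 * V r f * inverse (real N)) \<longlonglongrightarrow> 0"
    by (intro tendsto_mult_right_zero lim_inverse_n)
  ultimately have "(\<lambda>N. ?S N - (- dirichlet_conv f mangoldt r)) \<longlonglongrightarrow> 0"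
    by (rule Lim_null_comparison)
  then show ?thesis
    unfolding sums_def by (rule LIM_zero_cancel)
qed

theorem proposition10:
  shows "(\<exists>K::real. \<forall>(r::nat) (f :: nat \<Rightarrow> complex) (x::real).
            r \<ge> 1 \<longrightarrow> r_even r f \<longrightarrow> x \<ge> 1 \<longrightarrow>
            norm ((\<Sum>n=1..nat \<lfloor>x\<rfloor>. dft r f n / of_nat n)
                  - (f r * of_real (ln x + euler_mascheroni) - dirichlet_conv f mangoldt r))
              \<le> K * (V r f / x))
       \<and> (\<forall>(r::nat) (f :: nat \<Rightarrow> complex).
            r \<ge> 1 \<longrightarrow> r_even r f \<longrightarrow> f r = 0 \<longrightarrow>
            (\<lambda>n. dft r f (Suc n) / of_nat (Suc n)) sums (- dirichlet_conv f mangoldt r))"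
proof (intro conjI exI[of _ 2] allI impI)
  fix r :: nat and f :: "nat \<Rightarrow> complex" and x :: real
  assume "r \<ge> 1" "r_even r f" "x \<ge> 1"
  then show "norm ((\<Sum>n=1..nat \<lfloor>x\<rfloor>. dft r f n / of_nat n)
               - (f r * of_real (ln x + euler_mascheroni) - dirichlet_conv f mangoldt r))
             \<le> 2 * (V r f / x)"
    by (intro sum_dft_asymptotics) auto
next
  fix r :: nat and f :: "nat \<Rightarrow> complex"
  assume "r \<ge> 1" "r_even r f" "f r = 0"
  then show "(\<lambda>n. dft r f (Suc n) / of_nat (Suc n)) sums (- dirichlet_conv f mangoldt r)"
    by (intro dft_series_sums) auto
qed

end
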